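(* Consider the MGU network composed of $L$ stacked MGU layers, with initial hidden states $\boldsymbol h_0^{(l)}\in[-1,1]^{n_h^{(l)}}$ for every $l\in\{1,\dots,L\}$ and inputs $\boldsymbol u_k\in\mathcal U=[-1,1]^{n_u}$ for all $k\in\mathbb N$. If $$\bar\sigma_f^{(l)}\,\|R_{\tilde h}^{(l)}\|<1,\qquad \bar\sigma_f^{(l)}:=\sigma\left(\left\|\begin{bmatrix}W_f^{(l)} & R_f^{(l)} & \boldsymbol b_f^{(l)}\end{bmatrix}\right\|\right),$$ holds for every layer $l\in\{1,\dots,L\}$, then the MGU network is ISS in $\mathcal H_{\mathrm{inv}}=\prod_{l=1}^L[-1,1]^{n_h^{(l)}}$ with respect to $\mathcal U$.
   Context: Notation: $\mathbb N$ includes $0$; $\|\cdot\|$ is the infinity norm of vectors and the induced infinity norm of matrices (maximum absolute row sum); $\circ$ is the element-wise product; $\sigma(x)=1/(1+e^{-x})$ and $\phi(x)=\tanh(x)$; bold $\boldsymbol\sigma,\boldsymbol\phi$ denote component-wise application; $\boldsymbol 1_n$ is the all-ones vector; $[A\ B\ C]$ is horizontal concatenation. MGU network: layer $l\in\{1,\dots,L\}$ has hidden state $\boldsymbol h_k^{(l)}\in\mathbb R^{n_h^{(l)}}$ and input $\tilde{\boldsymbol u}_k^{(l)}\in\mathbb R^{n_{\tilde u}^{(l)}}$, where $\tilde{\boldsymbol u}_k^{(1)}=\boldsymbol u_k\in\mathbb R^{n_u}$ and $\tilde{\boldsymbol u}_k^{(l)}=\boldsymbol h_{k+1}^{(l-1)}$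 for $l\ge2$ (so $n_{\tilde u}^{(1)}=n_u$, $n_{\tilde u}^{(l)}=n_h^{(l-1)}$ for $l\ge 2$), and $$\boldsymbol f_k^{(l)}=\boldsymbol\sigma(W_f^{(l)}\tilde{\boldsymbol u}_k^{(l)}+R_f^{(l)}\boldsymbol h_k^{(l)}+\boldsymbol b_f^{(l)}),$$ $$\tilde{\boldsymbol h}_k^{(l)}=\boldsymbol\phi(W_{\tilde h}^{(l)}\tilde{\boldsymbol u}_k^{(l)}+R_{\tilde h}^{(l)}(\boldsymbol f_k^{(l)}\circ\boldsymbol h_k^{(l)})+\boldsymbol b_{\tilde h}^{(l)}),$$ $$\boldsymbol h_{k+1}^{(l)}=(\boldsymbol 1_{n_h^{(l)}}-\boldsymbol f_k^{(l)})\circ\boldsymbol h_k^{(l)}+\boldsymbol f_k^{(l)}\circ\tilde{\boldsymbol h}_k^{(l)},$$ where $W_f^{(l)},W_{\tilde h}^{(l)}\in\mathbb R^{n_h^{(l)}\times n_{\tilde u}^{(l)}}$, $R_f^{(l)},R_{\tilde h}^{(l)}\in\mathbb R^{n_h^{(l)}\times n_h^{(l)}}$, $\boldsymbol b_f^{(l)},\boldsymbol b_{\tilde h}^{(l)}\in\mathbb R^{n_h^{(l)}}$. The output is $\boldsymbol y_k=W_y\boldsymbol h_{k+1}^{(L)}+\boldsymbol b_y$ (irrelevant for state stability). The network state is $\boldsymbol h_k=[\boldsymbol h_k^{(1)\top},\dots,\boldsymbol h_k^{(L)\top}]^\top\in\mathbb R^{n_h}$, $n_h=\sum_l n_h^{(l)}$,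 which evolves as a system with input $\boldsymbol u_k$. Comparison functions: $\gamma:\mathbb R_{\ge0}\to\mathbb R_{\ge0}$ is class $\mathcal K$ if continuous, strictly increasing, $\gamma(0)=0$; class $\mathcal K_\infty$ if moreover $\gamma(r)\to\infty$ as $r\to\infty$. A continuous $\psi:\mathbb R_{\ge0}\times\mathbb N\to\mathbb R_{\ge0}$ is class $\mathcal{KL}$ if $\psi(\cdot,k)\in\mathcal K$ for each fixed $k$ and, for each fixed $r>0$, $\psi(r,k)$ is strictly decreasing to zero as $k\to\infty$. ISS (with bias term): a system $\boldsymbol x_{k+1}=\boldsymbol w(\boldsymbol x_k,\boldsymbol u_k)$ is ISS in a compact forward invariant set $\mathcal X$ with respect to a compact set $\mathcal U$ if there exist $\psi\in\mathcal{KL}$ and $\gamma_u,\gamma_b\in\mathcal K_\infty$ such that for any $k\in\mathbb N$, any $\boldsymbol x_0\in\mathcal X$, any inputs $\boldsymbol u_0,\dots,\boldsymbol u_{k-1}\in\mathcal U$, and any bias vector $\boldsymbol b$, $$\|\boldsymbol x_k\|\le\psi(\|\boldsymbol x_0\|,k)+\gamma_u\Big(\max_{0\le z<k}\|\boldsymbol u_z\|\Big)+\gamma_b(\|\boldsymbol b\|),$$ with the maximum over an empty set taken to be $0$. For the MGU network, $\boldsymbol x_k=\boldsymbol h_k$ and the bias vector is $\boldsymbol b=[\boldsymbol b_{\tilde h}^{(1)\top},\dots,\boldsymbol b_{\tilde h}^{(L)\top}]^\top\in\mathbb R^{n_h}$: the functions $\psi,\gamma_u,\gamma_b$ may depend on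 all $W_f^{(l)},W_{\tilde h}^{(l)},R_f^{(l)},R_{\tilde h}^{(l)},\boldsymbol b_f^{(l)}$, and the bound holds for every value of $\boldsymbol b$. *)

theory Defs
  imports "HOL-Analysis.Abstract_Metric_Spaces" "Jordan_Normal_Form.Matrix"
begin

section \<open>Infinity norms\<close>

text \<open>Inserting \<open>0\<close> changes nothing in positive dimension and makes the norm of an empty
  vector or matrix \<open>0\<close>.\<close>

definition vec_norm_inf :: "real vec \<Rightarrow> real" where
  "vec_norm_inf v = Max (insert 0 ((\<lambda>i. \<bar>v $ i\<bar>) ` {..<dim_vec v}))"

definition mat_norm_inf :: "real mat \<Rightarrow> real" where
  "mat_norm_inf A =
    Max (insert 0 ((\<lambda>i. \<Sum>j<dim_col A. \<bar>A $$ (i, j)\<bar>) ` {..<dim_row A}))"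

text \<open>The conditional is needed because \<open>Metric_space\<close> demands symmetry for all values of the
  type, and \<open>v - w\<close> is ill-behaved if the dimensions differ.\<close>

definition vec_dist_inf :: "real vec \<Rightarrow> real vec \<Rightarrow> real" where
  "vec_dist_inf v w = (if dim_vec v = dim_vec w then vec_norm_inf (v - w) else 0)"

definition unit_cube :: "nat \<Rightarrow> real vec set" where
  "unit_cube n = {v \<in> carrier_vec n. \<forall>i<n. v $ i \<in> {-1..1}}"

lemma vec_norm_inf_nonneg: "0 \<le> vec_norm_inf v"
  by (simp add: vec_norm_inf_def)

lemma vec_norm_inf_le_iff:
  "vec_norm_inf v \<le> c \<longleftrightarrow> 0 \<le> c \<and> (\<forall>i<dim_vec v. \<bar>v $ i\<bar> \<le> c)"
  by (auto simp: vec_norm_inf_def)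

lemma abs_le_vec_norm_inf: "i < dim_vec v \<Longrightarrow> \<bar>v $ i\<bar> \<le> vec_norm_inf v"
  using vec_norm_inf_le_iff by blast

lemma Metric_space_vec: "Metric_space (carrier_vec n) vec_dist_inf"
proof
  fix x y z :: "real vec"
  show "0 \<le> vec_dist_inf x y"
    by (simp add: vec_dist_inf_def vec_norm_inf_nonneg)
  show "vec_dist_inf x y = vec_dist_inf y x"
  proof (cases "dim_vec x = dim_vec y")
    case True
    then have "(\<lambda>i. \<bar>(x - y) $ i\<bar>) ` {..<dim_vec (x - y)} = (\<lambda>i. \<bar>(y - x) $ i\<bar>) ` {..<dim_vec (y - x)}"
      by (intro image_cong) auto
    then show ?thesis
      using True by (simp add: vec_dist_inf_def vec_norm_inf_def)
  qed (simp add: vec_dist_inf_def)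
  show "vec_dist_inf x y = 0 \<longleftrightarrow> x = y" if "x \<in> carrier_vec n" "y \<in> carrier_vec n"
  proof -
    have "vec_dist_inf x y = 0 \<longleftrightarrow> vec_norm_inf (x - y) \<le> 0"
      using that vec_norm_inf_nonneg[of "x - y"] by (auto simp: vec_dist_inf_def)
    also have "\<dots> \<longleftrightarrow> x = y"
      using that by (auto simp: vec_norm_inf_le_iff)
    finally show ?thesis .
  qed
  show "vec_dist_inf x z \<le> vec_dist_inf x y + vec_dist_inf y z"
    if c: "x \<in> carrier_vec n" "y \<in> carrier_vec n" "z \<in> carrier_vec n"
  proof -
    have "vec_norm_inf (x - z) \<le> vec_norm_inf (x - y) + vec_norm_inf (y - z)"
      unfolding vec_norm_inf_le_iff[of "x - z"]
    proof (intro conjI allI impI)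
      show "0 \<le> vec_norm_inf (x - y) + vec_norm_inf (y - z)"
        by (simp add: vec_norm_inf_nonneg)
      fix i assume "i < dim_vec (x - z)"
      then have i: "i < n" using c by simp
      have "\<bar>(x - y) $ i\<bar> \<le> vec_norm_inf (x - y)" "\<bar>(y - z) $ i\<bar> \<le> vec_norm_inf (y - z)"
        by (rule abs_le_vec_norm_inf, use i c in simp)+
      then show "\<bar>(x - z) $ i\<bar> \<le> vec_norm_inf (x - y) + vec_norm_inf (y - z)"
        using i c by simp
    qed
    then show ?thesis
      using c by (simp add: vec_dist_inf_def)
  qed
qed


section \<open>Input-to-state stability with a bias term\<close>

definition class_K :: "(real \<Rightarrow> real) \<Rightarrow> bool" where
  "class_K \<gamma> \<longleftrightarrow>
    \<gamma> ` {0..} \<subseteq> {0..} \<and> continuous_on {0..} \<gamma> \<and> strict_mono_on {0..} \<gamma> \<and> \<gamma> 0 = 0"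

definition class_K_inf :: "(real \<Rightarrow> real) \<Rightarrow> bool" where
  "class_K_inf \<gamma> \<longleftrightarrow> class_K \<gamma> \<and> filterlim \<gamma> at_top at_top"

definition class_KL :: "(real \<Rightarrow> nat \<Rightarrow> real) \<Rightarrow> bool" where
  "class_KL \<psi> \<longleftrightarrow>
    continuous_on ({0..} \<times> UNIV) (\<lambda>(r, k). \<psi> r k) \<and>
    (\<forall>k. class_K (\<lambda>r. \<psi> r k)) \<and>
    (\<forall>r>0. (\<forall>i j. i < j \<longrightarrow> \<psi> r j < \<psi> r i) \<and> \<psi> r \<longlonglongrightarrow> 0)"

primrec trajectory :: "('x \<Rightarrow> 'u \<Rightarrow> 'x) \<Rightarrow> 'x \<Rightarrow> (nat \<Rightarrow> 'u) \<Rightarrow> nat \<Rightarrow> 'x" where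
  "trajectory w x0 u 0 = x0"
| "trajectory w x0 u (Suc k) = w (trajectory w x0 u k) (u k)"

definition compact_vec_set :: "nat \<Rightarrow> real vec set \<Rightarrow> bool" where
  "compact_vec_set n S \<longleftrightarrow> compactin (Metric_space.mtopology (carrier_vec n) vec_dist_inf) S"

text \<open>\<open>w b\<close> is the state map of the system with bias vector \<open>b\<close>; the numbers \<open>n\<close>, \<open>m\<close>, \<open>q\<close> are
  the dimensions of state, input and bias. The comparison functions are chosen before the
  bias. The inserted \<open>0\<close> makes the maximum over the empty set \<open>0\<close>.\<close>

definition ISS_with_bias ::
  "nat \<Rightarrow> nat \<Rightarrow> nat \<Rightarrow> (real vec \<Rightarrow> real vec \<Rightarrow> real vec \<Rightarrow> real vec) \<Rightarrow>
    real vec set \<Rightarrow> real vec set \<Rightarrow> bool" where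
  "ISS_with_bias n m q w X U \<longleftrightarrow>
    compact_vec_set n X \<and> compact_vec_set m U \<and>
    (\<forall>b\<in>carrier_vec q. \<forall>x\<in>X. \<forall>u\<in>U. w b x u \<in> X) \<and>
    (\<exists>\<psi> \<gamma>\<^sub>u \<gamma>\<^sub>b. class_KL \<psi> \<and> class_K_inf \<gamma>\<^sub>u \<and> class_K_inf \<gamma>\<^sub>b \<and>
      (\<forall>k. \<forall>x0\<in>X. \<forall>u. (\<forall>z<k. u z \<in> U) \<longrightarrow>
        (\<forall>b\<in>carrier_vec q.
          vec_norm_inf (trajectory (w b) x0 u k)
            \<le> \<psi> (vec_norm_inf x0) k
              + \<gamma>\<^sub>u (Max (insert 0 ((\<lambda>z. vec_norm_inf (u z)) ` {..<k})))
              + \<gamma>\<^sub>b (vec_norm_inf b))))"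


section \<open>Stacked vectors\<close>

primrec stack_vec :: "nat \<Rightarrow> (nat \<Rightarrow> real vec) \<Rightarrow> real vec" where
  "stack_vec 0 x = vNil"
| "stack_vec (Suc l) x = stack_vec l x @\<^sub>v x (Suc l)"

definition vec_block :: "(nat \<Rightarrow> nat) \<Rightarrow> real vec \<Rightarrow> nat \<Rightarrow> real vec" where
  "vec_block d x l = vec (d l) (\<lambda>i. x $ ((\<Sum>j\<in>{1..<l}. d j) + i))"

lemma stack_vec_carrier:
  "(\<And>l. l \<in> {1..L} \<Longrightarrow> x l \<in> carrier_vec (d l)) \<Longrightarrow>
    stack_vec L x \<in> carrier_vec (\<Sum>l\<in>{1..L}. d l)"
  by (induction L) auto

lemma vec_block_stack_vec:
  assumes "\<And>l. l \<in> {1..L} \<Longrightarrow> x l \<in> carrier_vec (d l)" and "l \<in> {1..L}"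
  shows "vec_block d (stack_vec L x) l = x l"
  using assms
proof (induction L)
  case 0
  then show ?case by simp
next
  case (Suc L)
  have dims: "dim_vec (stack_vec L x) = (\<Sum>j\<in>{1..L}. d j)" "dim_vec (x (Suc L)) = d (Suc L)"
    using stack_vec_carrier[of L x d] Suc.prems(1)[of "Suc L"] Suc.prems(1) by auto
  show ?case
  proof (cases "l = Suc L")
    case True
    have "{1..<Suc L} = {1..L}" by auto
    with True dims show ?thesis
      by (auto simp: vec_block_def)
  next
    case False
    with Suc.prems have l: "l \<in> {1..L}" by auto
    have "(\<Sum>j\<in>{1..<l}. d j) + d l = (\<Sum>j\<in>{1..l}. d j)"
      using l by (cases l) (auto simp: atLeastLessThanSuc_atLeastAtMost)
    also have "\<dots> \<le> (\<Sum>j\<in>{1..L}. d j)"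
      using l by (intro sum_mono2) auto
    finally have le: "(\<Sum>j\<in>{1..<l}. d j) + d l \<le> dim_vec (stack_vec L x)"
      using dims by simp
    have "vec_block d (stack_vec (Suc L) x) l = vec_block d (stack_vec L x) l"
      unfolding vec_block_def using le by (intro eq_vecI) auto
    then show ?thesis
      using Suc.IH[OF _ l] Suc.prems(1) by simp
  qed
qed


section \<open>The MGU network\<close>

definition sigmoid :: "real \<Rightarrow> real" where
  "sigmoid x = 1 / (1 + exp (- x))"

text \<open>The bias of the candidate state is not part of the record, because stability is
  required uniformly in it.\<close>

record mgu_params =
  W_f :: "real mat"
  W_h :: "real mat"
  R_f :: "real mat"
  R_h :: "real mat"
  b_f :: "real vec"

definition mgu_params_dim :: "nat \<Rightarrow> nat \<Rightarrow> mgu_params \<Rightarrow> bool" where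
  "mgu_params_dim nh nu p \<longleftrightarrow>
    W_f p \<in> carrier_mat nh nu \<and> W_h p \<in> carrier_mat nh nu \<and>
    R_f p \<in> carrier_mat nh nh \<and> R_h p \<in> carrier_mat nh nh \<and>
    b_f p \<in> carrier_vec nh"

definition mgu_forget :: "mgu_params \<Rightarrow> real vec \<Rightarrow> real vec \<Rightarrow> real vec" where
  "mgu_forget p u h = map_vec sigmoid (W_f p *\<^sub>v u + R_f p *\<^sub>v h + b_f p)"

definition mgu_candidate :: "mgu_params \<Rightarrow> real vec \<Rightarrow> real vec \<Rightarrow> real vec \<Rightarrow> real vec" where
  "mgu_candidate p b u h =
    map_vec tanh (W_h p *\<^sub>v u + R_h p *\<^sub>v component_mult (mgu_forget p u h) h + b)"

definition mgu_layer :: "mgu_params \<Rightarrow> real vec \<Rightarrow> real vec \<Rightarrow> real vec \<Rightarrow> real vec" where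
  "mgu_layer p b u h =
    component_mult (vec (dim_vec h) (\<lambda>_. 1) - mgu_forget p u h) h
      + component_mult (mgu_forget p u h) (mgu_candidate p b u h)"

text \<open>\<open>mgu_layer_next nh p b x u l\<close> is the next state of layer \<open>l\<close>, for network state \<open>x\<close>,
  network input \<open>u\<close> and stacked bias \<open>b\<close>; layer \<open>0\<close> stands for the network input, so that the
  input of layer \<open>l\<close> is always the value at \<open>l - 1\<close>.\<close>

primrec mgu_layer_next ::
  "(nat \<Rightarrow> nat) \<Rightarrow> (nat \<Rightarrow> mgu_params) \<Rightarrow> real vec \<Rightarrow> real vec \<Rightarrow> real vec \<Rightarrow> nat \<Rightarrow> real vec"
where
  "mgu_layer_next nh p b x u 0 = u"
| "mgu_layer_next nh p b x u (Suc l) =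
    mgu_layer (p (Suc l)) (vec_block nh b (Suc l)) (mgu_layer_next nh p b x u l)
      (vec_block nh x (Suc l))"

definition mgu_network ::
  "nat \<Rightarrow> (nat \<Rightarrow> nat) \<Rightarrow> (nat \<Rightarrow> mgu_params) \<Rightarrow> real vec \<Rightarrow> real vec \<Rightarrow> real vec \<Rightarrow> real vec"
where
  "mgu_network L nh p b x u = stack_vec L (mgu_layer_next nh p b x u)"

definition mgu_input_dim :: "nat \<Rightarrow> (nat \<Rightarrow> nat) \<Rightarrow> nat \<Rightarrow> nat" where
  "mgu_input_dim nu nh l = (if l = 1 then nu else nh (l - 1))"

definition mgu_H_inv :: "nat \<Rightarrow> (nat \<Rightarrow> nat) \<Rightarrow> real vec set" where
  "mgu_H_inv L nh = {stack_vec L h | h. \<forall>l\<in>{1..L}. h l \<in> unit_cube (nh l)}"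

definition mgu_sigma_bar :: "mgu_params \<Rightarrow> real" where
  "mgu_sigma_bar p =
    sigmoid (mat_norm_inf
      (mat_of_cols (dim_vec (b_f p)) (cols (W_f p) @ cols (R_f p) @ [b_f p])))"

end

theory Submission
  imports Defs
begin

text \<open>The infinity norm of each layer contracts up to its input and its candidate bias, and a
  cascade of contractions is input-to-state stable.

  One layer. As long as input and state lie in the unit cube, every entry of the argument of the
  forget gate is bounded by \<open>s = \<parallel>[W_f R_f b_f]\<parallel>\<close>, so every gate value \<open>f\<close> lies in
  \<open>[1 - \<sigma>(s), \<sigma>(s)]\<close>. Both ends matter. Since \<open>\<bar>tanh x\<bar> \<le> \<bar>x\<bar>\<close>, the upper end bounds the part of
  the candidate that comes from the old state by \<open>\<sigma>(s) \<parallel>R_h\<parallel> \<parallel>h\<parallel>\<close>, where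
  the factor \<open>\<sigma>(s) \<parallel>R_h\<parallel>\<close> is less than \<open>1\<close> by hypothesis. The new state is the average of old state and candidate with weights
  \<open>1 - f\<close> and \<open>f\<close>, so it gains from this only in proportion to \<open>f\<close>; the lower end keeps
  \<open>f\<close> away from \<open>0\<close>. The result is \<open>mgu_layer_norm_le\<close>: the new norm is at most
  \<open>\<kappa> \<parallel>h\<parallel> + \<parallel>W_h\<parallel> \<parallel>u\<parallel> + \<parallel>b\<parallel>\<close>, where \<open>\<kappa> = 1 - (1 - \<sigma>(s)) (1 - \<sigma>(s) \<parallel>R_h\<parallel>) < 1\<close>
  does not depend on the candidate bias.

  The network. The input of a layer other than the first is the new state of the layer below, which
  is bounded by a geometrically decaying part plus a constant part. Choosing one decay rate \<open>\<mu> < 1\<close> strictly above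
  all the \<open>\<kappa>\<close> absorbs the resonance between a decaying input and a contracting layer, so that each
  layer again has a bound of the form \<open>M \<mu>^k \<parallel>x\<^sub>0\<parallel> + G (max \<parallel>u\<parallel> + \<parallel>b\<parallel>)\<close> with larger
  constants (\<open>cascade_bound\<close>). This bound is linear in the initial state, the input and the
  bias, and so yields comparison functions.

  That the cube is forward invariant, which the gate bound relies on at all times, holds because
  the new state is an average of two points of the cube. Its compactness is inherited from a
  product of intervals.\<close>


section \<open>Scalar functions\<close>

lemma sigmoid_mono: "x \<le> y \<Longrightarrow> sigmoid x \<le> sigmoid y"
  by (simp add: sigmoid_def frac_le add_pos_pos)

lemma sigmoid_less_1: "sigmoid x < 1"
  by (simp add: sigmoid_def add_pos_pos)

lemma sigmoid_minus: "sigmoid (- x) = 1 - sigmoid x"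
proof -
  have "1 + exp x > 0" "1 + exp (- x) > 0" by (simp_all add: add_pos_pos)
  then show ?thesis
    by (simp add: sigmoid_def exp_minus field_simps)
qed

lemma abs_tanh_le_abs: "\<bar>tanh x\<bar> \<le> \<bar>x :: real\<bar>"
proof -
  have nonneg: "tanh y \<le> y" if "0 \<le> y" for y :: real
  proof -
    have "(\<lambda>x. x - tanh x) 0 \<le> (\<lambda>x. x - tanh x) y"
    proof (rule DERIV_nonneg_imp_nondecreasing[OF that])
      fix x :: real
      have "((\<lambda>x. x - tanh x) has_real_derivative (tanh x)\<^sup>2) (at x)"
        by (auto intro!: derivative_eq_intros)
      then show "\<exists>D. ((\<lambda>x. x - tanh x) has_real_derivative D) (at x) \<and> 0 \<le> D"
        by (intro exI[of _ "(tanh x)\<^sup>2"]) simp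
    qed
    then show ?thesis by simp
  qed
  show ?thesis
    using nonneg[of x] nonneg[of "- x"] by (cases "0 \<le> x") auto
qed


section \<open>Norms of matrices and of stacked vectors\<close>

lemma mat_norm_inf_nonneg: "0 \<le> mat_norm_inf A"
  by (simp add: mat_norm_inf_def)

lemma row_sum_le_mat_norm_inf:
  "i < dim_row A \<Longrightarrow> (\<Sum>j<dim_col A. \<bar>A $$ (i, j)\<bar>) \<le> mat_norm_inf A"
  unfolding mat_norm_inf_def by (intro Max_ge) auto

lemma abs_mult_mat_vec_le_row_sum:
  fixes A :: "real mat"
  assumes "i < dim_row A" "dim_vec v = dim_col A" "\<And>j. j < dim_col A \<Longrightarrow> \<bar>v $ j\<bar> \<le> c"
  shows "\<bar>(A *\<^sub>v v) $ i\<bar> \<le> (\<Sum>j<dim_col A. \<bar>A $$ (i, j)\<bar>) * c"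
proof -
  have "(A *\<^sub>v v) $ i = (\<Sum>j<dim_col A. A $$ (i, j) * v $ j)"
    using assms by (simp add: scalar_prod_def atLeast0LessThan)
  also have "\<bar>\<dots>\<bar> \<le> (\<Sum>j<dim_col A. \<bar>A $$ (i, j) * v $ j\<bar>)"
    by (rule sum_abs)
  also have "\<dots> \<le> (\<Sum>j<dim_col A. \<bar>A $$ (i, j)\<bar> * c)"
    using assms by (intro sum_mono) (auto simp: abs_mult intro: mult_left_mono)
  finally show ?thesis
    by (simp add: sum_distrib_right)
qed

lemma abs_mult_mat_vec_le_norm:
  assumes "i < dim_row A" "dim_vec v = dim_col A" "0 \<le> c"
    and "\<And>j. j < dim_col A \<Longrightarrow> \<bar>v $ j\<bar> \<le> c"
  shows "\<bar>(A *\<^sub>v v) $ i\<bar> \<le> mat_norm_inf A * c"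
  using abs_mult_mat_vec_le_row_sum[OF assms(1,2,4)]
    mult_right_mono[OF row_sum_le_mat_norm_inf[OF assms(1)] \<open>0 \<le> c\<close>] by linarith

lemma unit_cube_iff_norm: "v \<in> unit_cube n \<longleftrightarrow> v \<in> carrier_vec n \<and> vec_norm_inf v \<le> 1"
  by (auto simp: unit_cube_def vec_norm_inf_le_iff abs_le_iff)

lemma vec_norm_inf_append_le_iff:
  "vec_norm_inf (v @\<^sub>v w) \<le> c \<longleftrightarrow> vec_norm_inf v \<le> c \<and> vec_norm_inf w \<le> c"
proof -
  have "(\<forall>i<dim_vec v + dim_vec w. \<bar>(v @\<^sub>v w) $ i\<bar> \<le> c) \<longleftrightarrow>
      (\<forall>i<dim_vec v. \<bar>v $ i\<bar> \<le> c) \<and> (\<forall>i<dim_vec w. \<bar>w $ i\<bar> \<le> c)" (is "?l \<longleftrightarrow> ?r")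
  proof
    assume l: ?l
    show ?r
    proof (intro conjI allI impI)
      show "\<bar>v $ i\<bar> \<le> c" if "i < dim_vec v" for i
        using l[rule_format, of i] that by simp
      show "\<bar>w $ i\<bar> \<le> c" if "i < dim_vec w" for i
        using l[rule_format, of "dim_vec v + i"] that by simp
    qed
  qed auto
  then show ?thesis
    by (auto simp: vec_norm_inf_le_iff)
qed

lemma vec_norm_inf_stack_le_iff:
  "vec_norm_inf (stack_vec L x) \<le> c \<longleftrightarrow> 0 \<le> c \<and> (\<forall>l\<in>{1..L}. vec_norm_inf (x l) \<le> c)"
proof (induction L)
  case 0
  then show ?case by (simp add: vec_norm_inf_le_iff)
next
  case (Suc L)
  have "{1..Suc L} = insert (Suc L) {1..L}" by auto
  then show ?case
    using Suc by (auto simp: vec_norm_inf_append_le_iff)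
qed

lemma vec_block_carrier: "vec_block d v l \<in> carrier_vec (d l)"
  by (simp add: vec_block_def)

text \<open>Every vector is the stack of its blocks, so the network state may be treated one layer at
  a time.\<close>

lemma stack_vec_vec_block:
  assumes "v \<in> carrier_vec (\<Sum>l\<in>{1..L}. d l)"
  shows "stack_vec L (vec_block d v) = v"
proof -
  have "stack_vec L (vec_block d v) = vec (\<Sum>l\<in>{1..L}. d l) (\<lambda>i. v $ i)"
  proof (induction L)
    case 0
    show ?case by auto
  next
    case (Suc L)
    have "{1..<Suc L} = {1..L}" by auto
    then have "vec_block d v (Suc L) = vec (d (Suc L)) (\<lambda>i. v $ ((\<Sum>l\<in>{1..L}. d l) + i))"
      by (simp add: vec_block_def)
    then show ?case
      by (intro eq_vecI) (auto simp: Suc)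
  qed
  then show ?thesis
    using assms by auto
qed

lemma vec_norm_inf_vec_block_le:
  assumes "v \<in> carrier_vec (\<Sum>l\<in>{1..L}. d l)" "l \<in> {1..L}"
  shows "vec_norm_inf (vec_block d v l) \<le> vec_norm_inf v"
  using vec_norm_inf_stack_le_iff[of L "vec_block d v" "vec_norm_inf v"] assms
  by (simp add: stack_vec_vec_block)

lemma mgu_H_inv_eq_unit_cube: "mgu_H_inv L nh = unit_cube (\<Sum>l\<in>{1..L}. nh l)"
proof (intro equalityI subsetI)
  fix x assume "x \<in> mgu_H_inv L nh"
  then obtain h where h: "x = stack_vec L h" "\<forall>l\<in>{1..L}. h l \<in> unit_cube (nh l)"
    by (auto simp: mgu_H_inv_def)
  then show "x \<in> unit_cube (\<Sum>l\<in>{1..L}. nh l)"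
    using stack_vec_carrier[of L h nh]
    by (simp add: unit_cube_iff_norm vec_norm_inf_stack_le_iff)
next
  fix x assume x: "x \<in> unit_cube (\<Sum>l\<in>{1..L}. nh l)"
  then have c: "x \<in> carrier_vec (\<Sum>l\<in>{1..L}. nh l)" and "vec_norm_inf x \<le> 1"
    by (auto simp: unit_cube_iff_norm)
  then have "\<forall>l\<in>{1..L}. vec_block nh x l \<in> unit_cube (nh l)"
    using vec_norm_inf_vec_block_le[OF c]
    by (fastforce simp: unit_cube_iff_norm vec_block_carrier)
  then show "x \<in> mgu_H_inv L nh"
    unfolding mgu_H_inv_def using stack_vec_vec_block[OF c] by force
qed


section \<open>Compactness of the unit cube\<close>

text \<open>In finitely many coordinates the box of radius \<open>\<epsilon>/2\<close> around a point is open in the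
  product topology. Hence passing from coordinate functions to vectors is continuous, and Tychonoff's
  theorem for the product of intervals carries over.\<close>

lemma compact_vec_set_unit_cube: "compact_vec_set n (unit_cube n)"
proof -
  interpret Metric_space "carrier_vec n" vec_dist_inf
    by (rule Metric_space_vec)
  let ?X = "product_topology (\<lambda>_. euclideanreal) {..<n}"
  let ?I = "PiE {..<n} (\<lambda>_. {-1..1::real})"
  have compact: "compactin ?X ?I"
    by (simp add: compactin_PiE)
  have "continuous_map ?X mtopology (vec n)"
    unfolding continuous_map_to_metric
  proof (intro ballI allI impI)
    fix x :: "nat \<Rightarrow> real" and \<epsilon> :: real
    assume x: "x \<in> topspace ?X" and \<epsilon>: "0 < \<epsilon>"
    let ?U = "PiE {..<n} (\<lambda>i. {x i - \<epsilon>/2 <..< x i + \<epsilon>/2})"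
    have "openin ?X ?U"
      by (simp add: openin_PiE)
    moreover have "x \<in> ?U"
      using x \<epsilon> by (auto simp: PiE_iff)
    moreover have "vec n y \<in> mball (vec n x) \<epsilon>" if "y \<in> ?U" for y
    proof -
      have "\<bar>x i - y i\<bar> \<le> \<epsilon>/2" if "i < n" for i
        using PiE_mem[OF \<open>y \<in> ?U\<close>, of i] that
        unfolding greaterThanLessThan_iff lessThan_iff by linarith
      then have "vec_norm_inf (vec n x - vec n y) \<le> \<epsilon>/2"
        using \<epsilon> unfolding vec_norm_inf_le_iff by simp
      then show ?thesis
        using \<epsilon> by (simp add: vec_dist_inf_def)
    qed
    ultimately show "\<exists>U. openin ?X U \<and> x \<in> U \<and> (\<forall>y\<in>U. vec n y \<in> mball (vec n x) \<epsilon>)"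
      by blast
  qed
  then have "compactin mtopology (vec n ` ?I)"
    using compact by (rule image_compactin[rotated])
  also have "vec n ` ?I = unit_cube n"
  proof (intro equalityI subsetI)
    fix v assume v: "v \<in> unit_cube n"
    then have "v = vec n (restrict (vec_index v) {..<n})"
      by (auto simp: unit_cube_def)
    moreover have "restrict (vec_index v) {..<n} \<in> ?I"
      using v by (auto simp: unit_cube_def)
    ultimately show "v \<in> vec n ` ?I"
      by blast
  next
    fix v assume "v \<in> vec n ` ?I"
    then obtain f where f: "f \<in> ?I" and v: "v = vec n f"
      by blast
    have "f i \<in> {-1..1}" if "i < n" for i
      using PiE_mem[OF f, of i] that by simp
    then show "v \<in> unit_cube n"
      unfolding v unit_cube_def by simp
  qed
  finally show ?thesis
    unfolding compact_vec_set_def .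
qed


section \<open>One layer\<close>

text \<open>The matrix \<open>[W R b]\<close> acts on the stack of \<open>u\<close>, \<open>h\<close> and the number \<open>1\<close>. The column of
  the bias is thus on the same footing as the others when \<open>u\<close> and \<open>h\<close> lie in the unit cube.\<close>

lemma abs_affine_le_concat_norm:
  assumes W: "W \<in> carrier_mat n m" and R: "R \<in> carrier_mat n n" and b: "b \<in> carrier_vec n"
    and u: "u \<in> unit_cube m" and h: "h \<in> unit_cube n" and i: "i < n"
  shows "\<bar>(W *\<^sub>v u + R *\<^sub>v h + b) $ i\<bar> \<le> mat_norm_inf (mat_of_cols n (cols W @ cols R @ [b]))"
proof -
  let ?cs = "cols W @ cols R @ [b]"
  have row: "sum_list (map (\<lambda>c. \<bar>c $ i\<bar>) (cols A)) = (\<Sum>j<dim_col A. \<bar>A $$ (i, j)\<bar>)"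
    if "A \<in> carrier_mat n k" for A :: "real mat" and k
    using that i by (simp add: cols_def o_def sum_list_sum_nth atLeast0LessThan)
  have concat_row: "sum_list (map (\<lambda>c. \<bar>c $ i\<bar>) cs) = (\<Sum>j<length cs. \<bar>mat_of_cols n cs $$ (i, j)\<bar>)"
    for cs :: "real vec list"
    using i by (simp add: sum_list_sum_nth atLeast0LessThan mat_of_cols_index)
  have abs_le_1: "\<bar>v $ j\<bar> \<le> 1" if "v \<in> unit_cube k" "j < k"
    for v :: "real vec" and k j
    using that by (auto simp: unit_cube_def abs_le_iff)
  have dims: "dim_vec u = m" "dim_vec h = n"
    using u h by (auto simp: unit_cube_def)
  have "\<bar>(W *\<^sub>v u) $ i\<bar> \<le> (\<Sum>j<dim_col W. \<bar>W $$ (i, j)\<bar>) * 1"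
    using i W dims abs_le_1[OF u] by (intro abs_mult_mat_vec_le_row_sum) auto
  moreover have "\<bar>(R *\<^sub>v h) $ i\<bar> \<le> (\<Sum>j<dim_col R. \<bar>R $$ (i, j)\<bar>) * 1"
    using i R dims abs_le_1[OF h] by (intro abs_mult_mat_vec_le_row_sum) auto
  moreover have "(W *\<^sub>v u + R *\<^sub>v h + b) $ i = (W *\<^sub>v u) $ i + (R *\<^sub>v h) $ i + b $ i"
    using i W R b by simp
  ultimately have "\<bar>(W *\<^sub>v u + R *\<^sub>v h + b) $ i\<bar> \<le> sum_list (map (\<lambda>c. \<bar>c $ i\<bar>) ?cs)"
    by (simp add: row[OF W] row[OF R])
  also have "\<dots> = (\<Sum>j<length ?cs. \<bar>mat_of_cols n ?cs $$ (i, j)\<bar>)"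
    by (rule concat_row)
  also have "\<dots> \<le> mat_norm_inf (mat_of_cols n ?cs)"
    using row_sum_le_mat_norm_inf[of i "mat_of_cols n ?cs"] i by simp
  finally show ?thesis .
qed

lemma mgu_sigma_bar_ge_half: "1 / 2 \<le> mgu_sigma_bar p"
  using sigmoid_mono[OF mat_norm_inf_nonneg] unfolding mgu_sigma_bar_def
  by (simp add: sigmoid_def)

lemma mgu_sigma_bar_less_1: "mgu_sigma_bar p < 1"
  by (simp add: mgu_sigma_bar_def sigmoid_less_1)

lemma dim_mgu_forget: "mgu_params_dim n m p \<Longrightarrow> dim_vec (mgu_forget p u h) = n"
  by (auto simp: mgu_forget_def mgu_params_dim_def)

lemma mgu_forget_bounds:
  assumes "mgu_params_dim n m p" "u \<in> unit_cube m" "h \<in> unit_cube n" "i < n"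
  shows "mgu_forget p u h $ i \<in> {1 - mgu_sigma_bar p..mgu_sigma_bar p}"
proof -
  let ?z = "(W_f p *\<^sub>v u + R_f p *\<^sub>v h + b_f p) $ i"
  let ?s = "mat_norm_inf (mat_of_cols n (cols (W_f p) @ cols (R_f p) @ [b_f p]))"
  have "\<bar>?z\<bar> \<le> ?s"
    using assms by (intro abs_affine_le_concat_norm) (auto simp: mgu_params_dim_def)
  \<comment> \<open>The symmetry \<open>\<sigma>(-s) = 1 - \<sigma>(s)\<close> turns the lower bound \<open>-s\<close> into the lower end.\<close>
  then have "sigmoid (- ?s) \<le> sigmoid ?z" "sigmoid ?z \<le> sigmoid ?s"
    by (auto intro: sigmoid_mono)
  moreover have "mgu_forget p u h $ i = sigmoid ?z" "dim_vec (b_f p) = n"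
    using assms by (auto simp: mgu_forget_def mgu_params_dim_def)
  ultimately show ?thesis
    by (simp add: mgu_sigma_bar_def sigmoid_minus)
qed

lemma mgu_layer_carrier:
  assumes "mgu_params_dim n m p" "b \<in> carrier_vec n" "h \<in> carrier_vec n"
  shows "mgu_layer p b u h \<in> carrier_vec n"
  using assms dim_mgu_forget[OF assms(1), of u h]
  by (intro carrier_vecI) (simp add: mgu_layer_def mgu_candidate_def dim_component_mult)

lemma mgu_layer_index:
  assumes "mgu_params_dim n m p" "b \<in> carrier_vec n" "h \<in> carrier_vec n" "i < n"
  shows "mgu_layer p b u h $ i =
    (1 - mgu_forget p u h $ i) * h $ i
      + mgu_forget p u h $ i
        * tanh ((W_h p *\<^sub>v u) $ i + (R_h p *\<^sub>v component_mult (mgu_forget p u h) h) $ i + b $ i)"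
proof -
  have "W_h p \<in> carrier_mat n m" "R_h p \<in> carrier_mat n n"
    using assms(1) by (auto simp: mgu_params_dim_def)
  then show ?thesis
    using assms dim_mgu_forget[OF assms(1), of u h]
    by (simp add: mgu_layer_def mgu_candidate_def index_component_mult dim_component_mult)
qed

text \<open>Each entry of the new state is a convex combination of an entry of the old state and a
  value of \<open>tanh\<close>.\<close>

lemma mgu_layer_unit_cube:
  assumes p: "mgu_params_dim n m p" and b: "b \<in> carrier_vec n"
    and u: "u \<in> unit_cube m" and h: "h \<in> unit_cube n"
  shows "mgu_layer p b u h \<in> unit_cube n"
proof -
  have hc: "h \<in> carrier_vec n"
    using h by (simp add: unit_cube_def)
  have "mgu_layer p b u h $ i \<in> {-1..1}" if i: "i < n" for i
  proof -
    let ?f = "mgu_forget p u h $ i"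
    have f: "?f \<in> {0..1}"
      using mgu_forget_bounds[OF p u h i] mgu_sigma_bar_less_1[of p] by auto
    have "(1 - ?f) * h $ i + ?f * tanh z \<in> {-1..1}" for z
      using convexD[OF convex_real_interval(5), of "h $ i" "-1" 1 "tanh z" "1 - ?f" ?f]
        f h i tanh_real_bounds[of z] by (auto simp: unit_cube_def)
    then show ?thesis
      by (simp add: mgu_layer_index[OF p b hc i])
  qed
  then show ?thesis
    using mgu_layer_carrier[OF p b hc] by (auto simp: unit_cube_def)
qed

text \<open>The least weight \<open>1 - \<sigma>(s)\<close> of the candidate, times the margin by which the candidate
  contracts the old state, is the decay guaranteed in one step.\<close>

definition mgu_contraction :: "mgu_params \<Rightarrow> real" where
  "mgu_contraction p =
    1 - (1 - mgu_sigma_bar p) * (1 - mgu_sigma_bar p * mat_norm_inf (R_h p))"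

lemma mgu_contraction_nonneg: "0 \<le> mgu_contraction p"
proof -
  have "mgu_sigma_bar p * mat_norm_inf (R_h p) \<ge> 0"
    using mgu_sigma_bar_ge_half[of p] mat_norm_inf_nonneg[of "R_h p"] by simp
  then have "(1 - mgu_sigma_bar p) * (1 - mgu_sigma_bar p * mat_norm_inf (R_h p))
      \<le> (1 - mgu_sigma_bar p) * 1"
    using mgu_sigma_bar_less_1[of p] by (intro mult_left_mono) auto
  also have "\<dots> \<le> 1"
    using mgu_sigma_bar_ge_half[of p] by simp
  finally have "(1 - mgu_sigma_bar p) * (1 - mgu_sigma_bar p * mat_norm_inf (R_h p)) \<le> 1" .
  then show ?thesis
    by (simp add: mgu_contraction_def)
qed

lemma mgu_contraction_less_1:
  "mgu_sigma_bar p * mat_norm_inf (R_h p) < 1 \<Longrightarrow> mgu_contraction p < 1"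
  using mgu_sigma_bar_less_1[of p] by (simp add: mgu_contraction_def)

text \<open>The gate enters twice: inside the candidate it scales the old state by at most
  \<open>\<sigma>(s)\<close>, and as a weight it moves the state towards the candidate with weight
  at least \<open>1 - \<sigma>(s)\<close>.\<close>

lemma mgu_layer_norm_le:
  assumes p: "mgu_params_dim n m p" and b: "b \<in> carrier_vec n"
    and u: "u \<in> unit_cube m" and h: "h \<in> unit_cube n"
    and contr: "mgu_sigma_bar p * mat_norm_inf (R_h p) < 1"
  shows "vec_norm_inf (mgu_layer p b u h) \<le>
    mgu_contraction p * vec_norm_inf h + mat_norm_inf (W_h p) * vec_norm_inf u + vec_norm_inf b"
proof -
  let ?s = "mgu_sigma_bar p" and ?R = "mat_norm_inf (R_h p)" and ?W = "mat_norm_inf (W_h p)"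
  let ?H = "vec_norm_inf h" and ?U = "vec_norm_inf u" and ?B = "vec_norm_inf b"
  have hc: "h \<in> carrier_vec n" and uc: "u \<in> carrier_vec m"
    using u h by (auto simp: unit_cube_def)
  have Wc: "W_h p \<in> carrier_mat n m" and Rc: "R_h p \<in> carrier_mat n n"
    using p by (auto simp: mgu_params_dim_def)
  have df: "dim_vec (mgu_forget p u h) = n"
    by (rule dim_mgu_forget[OF p])
  have s: "0 \<le> ?s"
    using mgu_sigma_bar_ge_half[of p] by simp
  have H: "0 \<le> ?H" and U: "0 \<le> ?U" and B: "0 \<le> ?B" and W: "0 \<le> ?W"
    by (rule vec_norm_inf_nonneg mat_norm_inf_nonneg)+
  have "\<bar>mgu_layer p b u h $ i\<bar> \<le> mgu_contraction p * ?H + ?W * ?U + ?B" if i: "i < n" for i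
  proof -
    let ?f = "mgu_forget p u h $ i"
    let ?z = "(W_h p *\<^sub>v u) $ i + (R_h p *\<^sub>v component_mult (mgu_forget p u h) h) $ i + b $ i"
    have f: "1 - ?s \<le> ?f" "0 \<le> ?f" "?f \<le> 1"
      using mgu_forget_bounds[OF p u h i] mgu_sigma_bar_less_1[of p] by auto
    have "\<bar>component_mult (mgu_forget p u h) h $ j\<bar> \<le> ?s * ?H" if j: "j < n" for j
    proof -
      have "\<bar>mgu_forget p u h $ j\<bar> \<le> ?s"
        using mgu_forget_bounds[OF p u h j] mgu_sigma_bar_less_1[of p] by auto
      moreover have "\<bar>h $ j\<bar> \<le> ?H"
        using abs_le_vec_norm_inf hc j by auto
      ultimately show ?thesis
        using j hc df s by (auto simp: index_component_mult abs_mult intro!: mult_mono)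
    qed
    then have "\<bar>(R_h p *\<^sub>v component_mult (mgu_forget p u h) h) $ i\<bar> \<le> ?R * (?s * ?H)"
      using i Rc hc df s H by (intro abs_mult_mat_vec_le_norm) (auto simp: dim_component_mult)
    moreover have "\<bar>(W_h p *\<^sub>v u) $ i\<bar> \<le> ?W * ?U"
      using i Wc uc U abs_le_vec_norm_inf[of _ u] by (intro abs_mult_mat_vec_le_norm) auto
    moreover have "\<bar>b $ i\<bar> \<le> ?B"
      using abs_le_vec_norm_inf b i by auto
    ultimately have z: "\<bar>tanh ?z\<bar> \<le> ?R * (?s * ?H) + (?W * ?U + ?B)"
      using abs_tanh_le_abs[of ?z] by linarith
    have hi: "\<bar>h $ i\<bar> \<le> ?H"
      using abs_le_vec_norm_inf hc i by auto
    have "\<bar>mgu_layer p b u h $ i\<bar> \<le> (1 - ?f) * \<bar>h $ i\<bar> + ?f * \<bar>tanh ?z\<bar>"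
      unfolding mgu_layer_index[OF p b hc i]
      using f abs_triangle_ineq[of "(1 - ?f) * h $ i" "?f * tanh ?z"] by (simp add: abs_mult)
    also have "\<dots> \<le> (1 - ?f) * ?H + ?f * (?R * (?s * ?H) + (?W * ?U + ?B))"
      using f hi z by (intro add_mono mult_left_mono) auto
    also have "\<dots> = (1 - ?f * (1 - ?s * ?R)) * ?H + ?f * (?W * ?U + ?B)"
      by (simp add: algebra_simps)
    also have "\<dots> \<le> mgu_contraction p * ?H + 1 * (?W * ?U + ?B)"
      using f contr H U B W unfolding mgu_contraction_def
      by (intro add_mono mult_right_mono) (auto intro!: mult_right_mono)
    finally show ?thesis by simp
  qed
  moreover have "0 \<le> mgu_contraction p * ?H + ?W * ?U + ?B"
    using mgu_contraction_nonneg[of p] H U B W by simp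
  ultimately show ?thesis
    using mgu_layer_carrier[OF p b hc, of u] by (auto simp: vec_norm_inf_le_iff)
qed


section \<open>Cascades of contractions\<close>

text \<open>With \<open>c = \<alpha> \<mu> / (\<mu> - \<kappa>)\<close> the sequence \<open>c \<mu>^k\<close> solves the recursion with
  the decaying forcing alone, since \<open>\<kappa> c + \<alpha> \<mu> = c \<mu>\<close>; this is where \<open>\<kappa> < \<mu>\<close> is needed.
  The constant forcing has the fixed point \<open>\<beta> / (1 - \<kappa>)\<close>.\<close>

lemma contraction_with_decaying_input:
  fixes x :: "nat \<Rightarrow> real"
  assumes step: "\<And>k. k < K \<Longrightarrow> x (Suc k) \<le> \<kappa> * x k + \<alpha> * \<mu> ^ Suc k + \<beta>"
    and init: "x 0 \<le> A"
    and "0 \<le> \<kappa>" "\<kappa> < \<mu>" "\<mu> < 1" "0 \<le> A" "0 \<le> \<alpha>" "0 \<le> \<beta>" "k \<le> K"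
  shows "x k \<le> (A + \<alpha> * \<mu> / (\<mu> - \<kappa>)) * \<mu> ^ k + \<beta> / (1 - \<kappa>)"
  using \<open>k \<le> K\<close>
proof (induction k)
  case 0
  have "0 \<le> \<alpha> * \<mu> / (\<mu> - \<kappa>)" "0 \<le> \<beta> / (1 - \<kappa>)"
    using assms by auto
  then show ?case
    using init by simp
next
  case (Suc k)
  define c where "c = \<alpha> * \<mu> / (\<mu> - \<kappa>)"
  define g where "g = \<beta> / (1 - \<kappa>)"
  have c: "\<kappa> * c + \<alpha> * \<mu> = \<mu> * c" and g: "\<kappa> * g + \<beta> = g"
    using assms by (auto simp: c_def g_def field_simps)
  have c0: "0 \<le> c"
    using assms by (auto simp: c_def)
  have "x (Suc k) \<le> \<kappa> * x k + \<alpha> * \<mu> ^ Suc k + \<beta>"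
    using step Suc.prems by simp
  also have "\<dots> \<le> \<kappa> * ((A + c) * \<mu> ^ k + g) + \<alpha> * \<mu> ^ Suc k + \<beta>"
    using mult_left_mono[OF Suc.IH \<open>0 \<le> \<kappa>\<close>] Suc.prems by (simp add: c_def g_def)
  also have "\<dots> = \<kappa> * A * \<mu> ^ k + (\<kappa> * c + \<alpha> * \<mu>) * \<mu> ^ k + (\<kappa> * g + \<beta>)"
    by (simp add: algebra_simps)
  also have "\<dots> \<le> \<mu> * A * \<mu> ^ k + \<mu> * c * \<mu> ^ k + g"
    unfolding c g using assms c0 by (intro add_mono mult_right_mono) auto
  finally show ?case
    by (simp add: c_def g_def algebra_simps)
qed

text \<open>Here \<open>a l k\<close> is the norm of layer \<open>l\<close> at time \<open>k\<close>, and layer \<open>0\<close> is the external input,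
  delayed by one step because layer \<open>l\<close> reads the new state of layer \<open>l - 1\<close>. The same \<open>v\<close>
  bounds this input and the bias.\<close>

definition cascade ::
  "nat \<Rightarrow> (nat \<Rightarrow> real) \<Rightarrow> (nat \<Rightarrow> real) \<Rightarrow> nat \<Rightarrow> real \<Rightarrow> real \<Rightarrow> (nat \<Rightarrow> nat \<Rightarrow> real) \<Rightarrow> bool"
where
  "cascade L \<kappa> w K A v a \<longleftrightarrow> 0 \<le> A \<and> 0 \<le> v \<and>
    (\<forall>l\<in>{1..L}. a l 0 \<le> A) \<and> (\<forall>k<K. a 0 (Suc k) \<le> v) \<and>
    (\<forall>l\<in>{1..L}. \<forall>k<K. a l (Suc k) \<le> \<kappa> l * a l k + w l * a (l - 1) (Suc k) + v)"

text \<open>Layer by layer, the bound for one layer is the decaying input of the next. The constants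
  must not depend on the sequences, because the comparison functions are chosen before initial
  state, input and bias. Increasing both constants along the cascade keeps the bounds of the lower
  layers valid.\<close>

lemma cascade_bound:
  assumes "\<And>l. l \<in> {1..L} \<Longrightarrow> 0 \<le> \<kappa> l \<and> \<kappa> l < \<mu>" and "\<And>l. l \<in> {1..L} \<Longrightarrow> 0 \<le> w l"
    and \<mu>: "0 < \<mu>" "\<mu> < 1"
  shows "\<exists>M G. 1 \<le> M \<and> 1 \<le> G \<and> (\<forall>K A v a. cascade L \<kappa> w K A v a \<longrightarrow>
    (\<forall>l\<in>{1..L}. \<forall>k\<le>K. a l k \<le> M * A * \<mu> ^ k + G * v))"
  using assms(1,2)
proof (induction L)
  case 0
  show ?case by (intro exI[of _ 1]) auto
next
  case (Suc L)
  have "\<exists>M G. 1 \<le> M \<and> 1 \<le> G \<and> (\<forall>K A v a. cascade L \<kappa> w K A v a \<longrightarrow>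
    (\<forall>l\<in>{1..L}. \<forall>k\<le>K. a l k \<le> M * A * \<mu> ^ k + G * v))"
    by (rule Suc.IH) (use Suc.prems in auto)
  then obtain M G where MG: "1 \<le> M" "1 \<le> G" and
    bound: "\<And>K A v a l k. \<lbrakk>cascade L \<kappa> w K A v a; l \<in> {1..L}; k \<le> K\<rbrakk> \<Longrightarrow>
      a l k \<le> M * A * \<mu> ^ k + G * v"
    by blast
  define l' where "l' = Suc L"
  have \<kappa>: "0 \<le> \<kappa> l'" "\<kappa> l' < \<mu>" and w: "0 \<le> w l'"
    using Suc.prems by (auto simp: l'_def)
  define c where "c = w l' * M * \<mu> / (\<mu> - \<kappa> l')"
  define g where "g = (w l' * G + 1) / (1 - \<kappa> l')"
  have c: "0 \<le> c" and g: "0 \<le> g"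
    using \<kappa> w \<mu> MG by (auto simp: c_def g_def)
  show ?case
  proof (rule exI[of _ "M + c"], rule exI[of _ "G + g"], intro conjI allI impI ballI)
    show "1 \<le> M + c" "1 \<le> G + g"
      using MG c g by auto
    fix a :: "nat \<Rightarrow> nat \<Rightarrow> real" and A v K l k
    assume a: "cascade (Suc L) \<kappa> w K A v a" and l: "l \<in> {1..Suc L}" and k: "k \<le> K"
    then have A: "0 \<le> A" and v: "0 \<le> v" and init: "\<And>l. l \<in> {1..Suc L} \<Longrightarrow> a l 0 \<le> A"
      and input: "\<And>k. k < K \<Longrightarrow> a 0 (Suc k) \<le> v"
      and step: "\<And>l k. \<lbrakk>l \<in> {1..Suc L}; k < K\<rbrakk> \<Longrightarrow>
        a l (Suc k) \<le> \<kappa> l * a l k + w l * a (l - 1) (Suc k) + v"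
      unfolding cascade_def by blast+
    have "cascade L \<kappa> w K A v a"
      using a by (auto simp: cascade_def)
    note lower = bound[OF this]
    show "a l k \<le> (M + c) * A * \<mu> ^ k + (G + g) * v"
    proof (cases "l = l'")
      case False
      then have "a l k \<le> M * A * \<mu> ^ k + G * v"
        using l k by (intro lower) (auto simp: l'_def)
      also have "\<dots> \<le> (M + c) * A * \<mu> ^ k + (G + g) * v"
        using c g A v \<mu> by (intro add_mono mult_right_mono) auto
      finally show ?thesis .
    next
      case True
      have below: "a L (Suc i) \<le> M * A * \<mu> ^ Suc i + G * v" if "i < K" for i
      proof (cases "L = 0")
        case True
        have "a 0 (Suc i) \<le> v" "0 \<le> M * A * \<mu> ^ Suc i" "1 * v \<le> G * v"
          using input that A \<mu> MG mult_right_mono[OF MG(2) v] by auto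
        then show ?thesis
          unfolding True by linarith
      next
        case False
        then show ?thesis
          using lower[of L "Suc i"] that by simp
      qed
      have rec: "a l' (Suc i) \<le> \<kappa> l' * a l' i + w l' * M * A * \<mu> ^ Suc i + (w l' * G + 1) * v"
        if "i < K" for i
      proof -
        have "a l' (Suc i) \<le> \<kappa> l' * a l' i + w l' * a L (Suc i) + v"
          using step[of l' i] that by (simp add: l'_def)
        also have "\<dots> \<le> \<kappa> l' * a l' i + w l' * (M * A * \<mu> ^ Suc i + G * v) + v"
          using mult_left_mono[OF below[OF that] w] by simp
        finally show ?thesis by (simp add: algebra_simps)
      qed
      have "a l' k \<le> (A + w l' * M * A * \<mu> / (\<mu> - \<kappa> l')) * \<mu> ^ k + (w l' * G + 1) * v / (1 - \<kappa> l')"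
        using contraction_with_decaying_input[of K "a l'", OF rec _ \<kappa> \<mu>(2) A _ _ k]
          init w MG A v by (auto simp: l'_def)
      also have "\<dots> = (1 + c) * A * \<mu> ^ k + g * v"
        by (simp add: c_def g_def algebra_simps)
      also have "\<dots> \<le> (M + c) * A * \<mu> ^ k + (G + g) * v"
        using MG A v \<mu> by (intro add_mono mult_right_mono) auto
      finally show ?thesis
        by (simp add: True)
    qed
  qed
qed

lemma uniform_decay_rate:
  fixes \<kappa> :: "nat \<Rightarrow> real"
  assumes "\<And>l. l \<in> {1..L} \<Longrightarrow> \<kappa> l < 1"
  obtains \<mu> where "0 < \<mu>" "\<mu> < 1" "\<And>l. l \<in> {1..L} \<Longrightarrow> \<kappa> l < \<mu>"
proof -
  let ?m = "Max (insert 0 (\<kappa> ` {1..L}))"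
  have "?m < 1"
    using assms by auto
  then obtain \<mu> where \<mu>: "?m < \<mu>" "\<mu> < 1"
    using dense by blast
  then show ?thesis
    by (intro that[of \<mu>]) auto
qed


section \<open>Comparison functions\<close>

lemma class_K_linear: "0 < c \<Longrightarrow> class_K (\<lambda>r. c * r)"
  by (auto simp: class_K_def strict_mono_on_def intro!: continuous_intros)

lemma class_K_inf_linear: "0 < c \<Longrightarrow> class_K_inf (\<lambda>r. c * r)"
  unfolding class_K_inf_def
  by (simp add: class_K_linear filterlim_tendsto_pos_mult_at_top[OF tendsto_const] filterlim_ident)

lemma class_KL_geometric:
  assumes "0 < M" "0 < \<mu>" "\<mu> < 1"
  shows "class_KL (\<lambda>r k. M * r * \<mu> ^ k)"
  unfolding class_KL_def
proof (intro conjI allI impI)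
  have "continuous_on ({0..} \<times> UNIV) (\<lambda>x::real \<times> nat. \<mu> ^ snd x)"
    by (rule continuous_on_compose2[of UNIV "\<lambda>k. \<mu> ^ k"]) (auto intro!: continuous_intros)
  then show "continuous_on ({0..} \<times> UNIV) (\<lambda>(r, k). M * r * \<mu> ^ k)"
    unfolding case_prod_beta by (intro continuous_intros)
  show "class_K (\<lambda>r. M * r * \<mu> ^ k)" for k
    using class_K_linear[of "M * \<mu> ^ k"] assms by (simp add: mult_ac)
  fix r :: real assume r: "0 < r"
  show "M * r * \<mu> ^ j < M * r * \<mu> ^ i" if "i < j" for i j
    using r assms that by (simp add: power_strict_decreasing)
  show "(\<lambda>k. M * r * \<mu> ^ k) \<longlonglongrightarrow> 0"
    using tendsto_mult_right_zero[OF LIMSEQ_realpow_zero[of \<mu>], of "M * r"] assms by simp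
qed


section \<open>The network\<close>

lemma mgu_layer_next_unit_cube:
  assumes "\<forall>l\<in>{1..L}. mgu_params_dim (nh l) (mgu_input_dim nu nh l) (p l)"
    and "x \<in> mgu_H_inv L nh" "u \<in> unit_cube nu" "l \<le> L"
  shows "mgu_layer_next nh p b x u l \<in> unit_cube (mgu_input_dim nu nh (Suc l))"
  using \<open>l \<le> L\<close>
proof (induction l)
  case 0
  then show ?case
    using assms by (simp add: mgu_input_dim_def)
next
  case (Suc l)
  have "vec_block nh x (Suc l) \<in> unit_cube (nh (Suc l))"
    using assms(2) Suc.prems vec_block_stack_vec[of L _ nh "Suc l"]
    by (auto simp: mgu_H_inv_def unit_cube_def)
  then have "mgu_layer_next nh p b x u (Suc l) \<in> unit_cube (nh (Suc l))"
    using assms(1) Suc by (auto intro!: mgu_layer_unit_cube vec_block_carrier)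
  then show ?case
    by (simp add: mgu_input_dim_def)
qed

lemma mgu_layer_next_unit_cube_state:
  assumes "\<forall>l\<in>{1..L}. mgu_params_dim (nh l) (mgu_input_dim nu nh l) (p l)"
    and "x \<in> mgu_H_inv L nh" "u \<in> unit_cube nu" "l \<in> {1..L}"
  shows "mgu_layer_next nh p b x u l \<in> unit_cube (nh l)"
  using mgu_layer_next_unit_cube[OF assms(1-3), of l] assms(4) by (simp add: mgu_input_dim_def)

lemma mgu_network_invariant:
  assumes "\<forall>l\<in>{1..L}. mgu_params_dim (nh l) (mgu_input_dim nu nh l) (p l)"
    and "x \<in> mgu_H_inv L nh" "u \<in> unit_cube nu"
  shows "mgu_network L nh p b x u \<in> mgu_H_inv L nh"
  unfolding mgu_network_def mgu_H_inv_def
  using mgu_layer_next_unit_cube_state[OF assms] by blast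

theorem theorem3:
  fixes L nu :: nat and nh :: "nat \<Rightarrow> nat" and p :: "nat \<Rightarrow> mgu_params"
  assumes "1 \<le> L"
    and "\<forall>l\<in>{1..L}. mgu_params_dim (nh l) (mgu_input_dim nu nh l) (p l)"
    and "\<forall>l\<in>{1..L}. mgu_sigma_bar (p l) * mat_norm_inf (R_h (p l)) < 1"
  shows "ISS_with_bias (\<Sum>l\<in>{1..L}. nh l) nu (\<Sum>l\<in>{1..L}. nh l)
    (mgu_network L nh p) (mgu_H_inv L nh) (unit_cube nu)"
proof -
  let ?n = "\<Sum>l\<in>{1..L}. nh l"
  define \<kappa> where "\<kappa> l = mgu_contraction (p l)" for l
  define w where "w l = mat_norm_inf (W_h (p l))" for l
  note dims = assms(2)
  have "\<kappa> l < 1" if "l \<in> {1..L}" for l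
    using assms(3) that by (simp add: \<kappa>_def mgu_contraction_less_1)
  then obtain \<mu> where \<mu>: "0 < \<mu>" "\<mu> < 1" "\<And>l. l \<in> {1..L} \<Longrightarrow> \<kappa> l < \<mu>"
    using uniform_decay_rate[of L \<kappa>] by blast
  have \<kappa>: "0 \<le> \<kappa> l \<and> \<kappa> l < \<mu>" if "l \<in> {1..L}" for l
    using \<mu>(3)[OF that] by (simp add: \<kappa>_def mgu_contraction_nonneg)
  have w: "0 \<le> w l" for l
    by (simp add: w_def mat_norm_inf_nonneg)
  obtain M G where MG: "1 \<le> M" "1 \<le> G" and
    bound: "\<And>K A v a l k. \<lbrakk>cascade L \<kappa> w K A v a; l \<in> {1..L}; k \<le> K\<rbrakk> \<Longrightarrow>
      a l k \<le> M * A * \<mu> ^ k + G * v"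
    using cascade_bound[of L \<kappa> \<mu> w, OF \<kappa> w \<mu>(1,2)] by blast
  have estimate: "vec_norm_inf (trajectory (mgu_network L nh p b) x0 u K)
      \<le> M * vec_norm_inf x0 * \<mu> ^ K
        + G * Max (insert 0 ((\<lambda>z. vec_norm_inf (u z)) ` {..<K})) + G * vec_norm_inf b"
    if x0: "x0 \<in> mgu_H_inv L nh" and u: "\<forall>z<K. u z \<in> unit_cube nu" and b: "b \<in> carrier_vec ?n"
    for K x0 u b
  proof -
    let ?U = "Max (insert 0 ((\<lambda>z. vec_norm_inf (u z)) ` {..<K}))"
    define x where "x = trajectory (mgu_network L nh p b) x0 u"
    have x_Suc: "x (Suc k) = stack_vec L (mgu_layer_next nh p b (x k) (u k))" for k
      by (simp add: x_def mgu_network_def)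
    have inv: "x k \<in> mgu_H_inv L nh" if "k \<le> K" for k
      using that
    proof (induction k)
      case 0
      then show ?case using x0 by (simp add: x_def)
    next
      case (Suc k)
      then show ?case
        using mgu_network_invariant[OF dims] u by (simp add: x_def)
    qed
    have carrier: "x k \<in> carrier_vec ?n" if "k \<le> K" for k
      using inv[OF that] by (simp add: mgu_H_inv_eq_unit_cube unit_cube_def)
    \<comment> \<open>The new state of layer \<open>1\<close> at time \<open>k + 1\<close> depends on \<open>u k\<close>, so in the cascade the input
      is shifted by one.\<close>
    define a where "a l k =
      (if l = 0 then vec_norm_inf (u (k - 1)) else vec_norm_inf (vec_block nh (x k) l))" for l k
    have a_Suc: "a l (Suc k) = vec_norm_inf (mgu_layer_next nh p b (x k) (u k) l)"
      if "l \<le> L" "k < K" for l k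
    proof (cases "l = 0")
      case False
      have "vec_block nh (x (Suc k)) l = mgu_layer_next nh p b (x k) (u k) l"
        unfolding x_Suc
      proof (rule vec_block_stack_vec)
        show "mgu_layer_next nh p b (x k) (u k) j \<in> carrier_vec (nh j)" if "j \<in> {1..L}" for j
          using mgu_layer_next_unit_cube_state[OF dims inv, of k "u k" j b] u that \<open>k < K\<close>
          by (simp add: unit_cube_def)
      qed (use False that in auto)
      then show ?thesis
        using False by (simp add: a_def)
    qed (simp add: a_def)
    have U: "vec_norm_inf (u k) \<le> ?U" if "k < K" for k
      using that by (intro Max_ge) auto
    have U0: "0 \<le> ?U"
      by simp
    have "cascade L \<kappa> w K (vec_norm_inf x0) (?U + vec_norm_inf b) a"
      unfolding cascade_def
    proof (intro conjI)
      show "0 \<le> vec_norm_inf x0" "0 \<le> ?U + vec_norm_inf b"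
        using U0 vec_norm_inf_nonneg[of b] by (auto simp: vec_norm_inf_nonneg)
      show "\<forall>l\<in>{1..L}. a l 0 \<le> vec_norm_inf x0"
        using vec_norm_inf_vec_block_le[OF carrier[of 0]] by (auto simp: a_def x_def)
      show "\<forall>k<K. a 0 (Suc k) \<le> ?U + vec_norm_inf b"
        using U vec_norm_inf_nonneg[of b] by (auto simp: a_def intro: add_increasing2)
      show "\<forall>l\<in>{1..L}. \<forall>k<K. a l (Suc k)
          \<le> \<kappa> l * a l k + w l * a (l - 1) (Suc k) + (?U + vec_norm_inf b)"
      proof (intro ballI allI impI)
        fix l k assume l: "l \<in> {1..L}" and k: "k < K"
        then obtain j where j: "l = Suc j"
          by (cases l) auto
        let ?v = "mgu_layer_next nh p b (x k) (u k) j"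
        have "vec_norm_inf (mgu_layer (p l) (vec_block nh b l) ?v (vec_block nh (x k) l))
          \<le> \<kappa> l * vec_norm_inf (vec_block nh (x k) l) + w l * vec_norm_inf ?v
            + vec_norm_inf (vec_block nh b l)"
          unfolding \<kappa>_def w_def
        proof (rule mgu_layer_norm_le)
          show "mgu_params_dim (nh l) (mgu_input_dim nu nh l) (p l)"
            using dims l by blast
          show "?v \<in> unit_cube (mgu_input_dim nu nh l)"
            using mgu_layer_next_unit_cube[OF dims inv, of k "u k" j b] u k l by (simp add: j)
          have "vec_norm_inf (x k) \<le> 1"
            using inv[of k] k by (simp add: mgu_H_inv_eq_unit_cube unit_cube_iff_norm)
          then show "vec_block nh (x k) l \<in> unit_cube (nh l)"
            using vec_norm_inf_vec_block_le[OF carrier l, of k] k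
            by (simp add: unit_cube_iff_norm vec_block_carrier)
          show "mgu_sigma_bar (p l) * mat_norm_inf (R_h (p l)) < 1"
            using assms(3) l by blast
        qed (rule vec_block_carrier)
        moreover have a1: "a l (Suc k)
          = vec_norm_inf (mgu_layer (p l) (vec_block nh b l) ?v (vec_block nh (x k) l))"
          using a_Suc[of l k] l k by (simp add: j)
        moreover have a2: "a (l - 1) (Suc k) = vec_norm_inf ?v"
          using a_Suc[of j k] l k by (simp add: j)
        moreover have a3: "a l k = vec_norm_inf (vec_block nh (x k) l)"
          by (simp add: a_def j)
        moreover have "vec_norm_inf (vec_block nh b l) \<le> vec_norm_inf b"
          by (rule vec_norm_inf_vec_block_le[OF b l])
        ultimately show "a l (Suc k)
            \<le> \<kappa> l * a l k + w l * a (l - 1) (Suc k) + (?U + vec_norm_inf b)"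
          unfolding a1 a2 a3 using U0 by linarith
      qed
    qed
    then have layers: "a l K \<le> M * vec_norm_inf x0 * \<mu> ^ K + G * (?U + vec_norm_inf b)"
      if "l \<in> {1..L}" for l
      using that by (rule bound) simp
    have "0 \<le> M * vec_norm_inf x0 * \<mu> ^ K + G * (?U + vec_norm_inf b)"
      using MG \<mu> U0 by (intro add_nonneg_nonneg mult_nonneg_nonneg vec_norm_inf_nonneg) auto
    then have "vec_norm_inf (stack_vec L (vec_block nh (x K)))
        \<le> M * vec_norm_inf x0 * \<mu> ^ K + G * (?U + vec_norm_inf b)"
      using layers by (auto simp: vec_norm_inf_stack_le_iff a_def)
    then show ?thesis
      using stack_vec_vec_block[OF carrier[of K]] by (simp add: x_def algebra_simps)
  qed
  have "class_KL (\<lambda>r k. M * r * \<mu> ^ k)" "class_K_inf (\<lambda>r. G * r)"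
    using MG \<mu> by (auto intro!: class_KL_geometric class_K_inf_linear)
  then have "\<exists>\<psi> \<gamma>\<^sub>u \<gamma>\<^sub>b. class_KL \<psi> \<and> class_K_inf \<gamma>\<^sub>u \<and> class_K_inf \<gamma>\<^sub>b \<and>
      (\<forall>k. \<forall>x0\<in>mgu_H_inv L nh. \<forall>u. (\<forall>z<k. u z \<in> unit_cube nu) \<longrightarrow>
        (\<forall>b\<in>carrier_vec ?n. vec_norm_inf (trajectory (mgu_network L nh p b) x0 u k)
          \<le> \<psi> (vec_norm_inf x0) k
            + \<gamma>\<^sub>u (Max (insert 0 ((\<lambda>z. vec_norm_inf (u z)) ` {..<k}))) + \<gamma>\<^sub>b (vec_norm_inf b)))"
    using estimate
    by (intro exI[of _ "\<lambda>r k. M * r * \<mu> ^ k"] exI[of _ "\<lambda>r. G * r"] conjI) blast+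
  moreover have "compact_vec_set ?n (mgu_H_inv L nh)" "compact_vec_set nu (unit_cube nu)"
    by (simp_all add: mgu_H_inv_eq_unit_cube compact_vec_set_unit_cube)
  moreover have "\<forall>b\<in>carrier_vec ?n. \<forall>x\<in>mgu_H_inv L nh. \<forall>u\<in>unit_cube nu.
      mgu_network L nh p b x u \<in> mgu_H_inv L nh"
    using mgu_network_invariant[OF dims] by blast
  ultimately show ?thesis
    unfolding ISS_with_bias_def by blast
qed

end
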